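(* Let $0<p<\frac12$, and put $\beta=\frac{p}{2p-1}$ and $\gamma=\frac{1-p}{p}$. Let $(d_k)_{k=0}^\infty$ be the unique positive bounded sequence satisfying $$d_0=\frac{1-p}{p},\qquad d_k=\frac{pk\,d_{k-1}+(1-p)k\,d_{k+1}}{k+p}\quad (k\ge 1).$$ Then, as $k\to\infty$, $$d_k\sim (-\beta)^{-1}(1-\beta)^{1-\beta}\,\Gamma(1-\beta)\,\gamma^{-k}k^{\beta}.$$
   Context: $\Gamma$ is the Gamma function, and $a_k\sim b_k$ means $a_k/b_k\to 1$ as $k\to\infty$. Note that $\beta<0$ and $\gamma>1$ here. *)

theory Defs
  imports "HOL-Analysis.Analysis" "HOL-Library.Landau_Symbols"
begin

definition pos_bounded_solution :: "real \<Rightarrow> (nat \<Rightarrow> real) \<Rightarrow> bool" where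
  "pos_bounded_solution p d \<longleftrightarrow>
     (\<forall>k. d k > 0) \<and> bounded (range d) \<and>
     d 0 = (1 - p) / p \<and>
     (\<forall>k\<ge>1. d k = (p * real k * d (k - 1) + (1 - p) * real k * d (k + 1)) / (real k + p))"

end

theory Submission
  imports Defs "HOL-Real_Asymp.Real_Asymp"
begin

text \<open>
  Write \<open>a = - \<beta>\<close> and \<open>r = p / (1 - p) = 1 / \<gamma>\<close>. Looking for a solution of the form
  \<open>\<integral> t\<^sup>k w(t) dt\<close> over \<open>[0, r]\<close> and integrating by parts turns the recurrence into a
  first-order differential equation for \<open>w\<close>. Solving it and substituting \<open>t = r s\<close> gives
  \<open>d\<^sub>k = r\<^sup>k I\<^sub>k\<close>, where \<open>I\<^sub>k\<close> is the integral of
  \<open>s\<^sup>k (1 - s)\<^bsup>a-1\<^esup> (1 - r s)\<^bsup>-a-1\<^esup>\<close> over \<open>[0, 1]\<close>. As the last factor is Lipschitz near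
  \<open>s = 1\<close>, \<open>I\<^sub>k\<close> equals \<open>(1 - r)\<^bsup>-a-1\<^esup> B(k + 1, a)\<close> up to a multiple of \<open>B(k + 1, a + 1)\<close>,
  and \<open>B(k + 1, a) \<sim> \<Gamma>(a) k\<^bsup>-a\<^esup>\<close>.

  For uniqueness, let \<open>e\<close> be the difference of two solutions, so \<open>e\<^sub>0 = 0\<close>. If \<open>e\<^sub>1 > 0\<close>, the
  recurrence makes \<open>e\<close> increasing with increments at least of order \<open>1 / k\<close>, so \<open>e\<close> is unbounded
  like the harmonic series; hence \<open>e\<^sub>1 = 0\<close> by symmetry and \<open>e\<close> vanishes.
\<close>

section \<open>Uniqueness of the bounded solution\<close>

lemma increasing_solution_unbounded:
  fixes e :: "nat \<Rightarrow> real" and p q :: real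
  assumes p: "0 < p" and pq: "p + q = 1" and q: "0 < q"
    and e0: "e 0 = 0" and e1: "0 < e 1"
    and rec: "\<And>k. k \<ge> 1 \<Longrightarrow> (real k + p) * e k = p * real k * e (k - 1) + q * real k * e (k + 1)"
  shows "\<not> bounded (range e)"
proof
  assume "bounded (range e)"
  then obtain B where B: "\<And>n. \<bar>e n\<bar> \<le> B"
    by (auto simp: bounded_iff)
  \<comment> \<open>The recurrence at \<open>n + 1\<close>, divided by \<open>n + 1\<close> and
    rewritten with increments; \<open>p + q = 1\<close> cancels the remaining multiple of
    \<open>e (n + 1)\<close>.\<close>
  have step: "q * (e (n + 2) - e (n + 1)) = p * (e (n + 1) - e n) + p * e (n + 1) / real (n + 1)" for n
  proof -
    have "real (n + 1) * (q * (e (n + 2) - e (n + 1)))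
        = real (n + 1) * (p * (e (n + 1) - e n)) + p * e (n + 1) + (1 - p - q) * real (n + 1) * e (n + 1)"
      using rec[of "n + 1"] by (simp add: algebra_simps)
    then show ?thesis
      using pq by (simp add: divide_simps) (simp add: algebra_simps)
  qed
  have incr: "e n < e (n + 1) \<and> e 1 \<le> e (n + 1)" for n
  proof (induction n)
    case 0
    then show ?case using e0 e1 by simp
  next
    case (Suc n)
    have "0 < p * (e (n + 1) - e n)" "0 < p * e (n + 1) / real (n + 1)"
      using Suc p e1 by (auto intro!: divide_pos_pos mult_pos_pos)
    then have "0 < q * (e (n + 2) - e (n + 1))"
      using step[of n] by linarith
    then show ?case
      using Suc q by (auto simp: zero_less_mult_iff)
  qed
  \<comment> \<open>Dropping the positive term \<open>p * (e (n + 1) - e n)\<close> from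
    \<open>step\<close> and using \<open>e 1 \<le> e (n + 1)\<close> leaves increments of at least
    \<open>c / (n + 1)\<close>.\<close>
  define c where "c = p * e 1 / q"
  have c: "c > 0" using p q e1 by (simp add: c_def)
  have lower: "c * harm n \<le> e (n + 1)" for n
  proof (induction n)
    case 0
    then show ?case using e1 by (simp add: harm_def)
  next
    case (Suc n)
    have "p * e 1 / real (n + 1) \<le> p * e (n + 1) / real (n + 1)"
      using incr[of n] p by (intro divide_right_mono mult_left_mono) auto
    also have "\<dots> \<le> q * (e (n + 2) - e (n + 1))"
      using incr[of n] p unfolding step by simp
    finally have "c / real (n + 1) \<le> e (n + 2) - e (n + 1)"
      using q by (simp add: c_def divide_simps mult_ac)
    then show ?case
      using Suc by (simp add: harm_Suc algebra_simps inverse_eq_divide)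
  qed
  have "\<forall>\<^sub>F n in sequentially. (harm n :: real) > B / c"
    using harm_at_top by (simp add: filterlim_at_top_dense)
  then obtain n where "B / c < harm n"
    by (auto simp: eventually_sequentially)
  then have "B < c * harm n"
    using c by (simp add: divide_simps mult_ac)
  then show False
    using lower[of n] B[of "n + 1"] by linarith
qed

lemma bounded_solution_eq_0:
  fixes e :: "nat \<Rightarrow> real" and p q :: real
  assumes p: "0 < p" and pq: "p + q = 1" and q: "0 < q"
    and bdd: "bounded (range e)" and e0: "e 0 = 0"
    and rec: "\<And>k. k \<ge> 1 \<Longrightarrow> (real k + p) * e k = p * real k * e (k - 1) + q * real k * e (k + 1)"
  shows "e k = 0"
proof -
  have "\<not> 0 < e 1"
    using increasing_solution_unbounded[OF p pq q e0 _ rec] bdd by blast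
  moreover have "\<not> 0 < - e 1"
  proof
    assume "0 < - e 1"
    then have "\<not> bounded (range (\<lambda>k. - e k))"
      using e0 rec by (intro increasing_solution_unbounded[OF p pq q]) (auto simp: algebra_simps)
    then show False
      using bdd by (auto simp: bounded_iff)
  qed
  ultimately have e1: "e 1 = 0" by simp
  have "e n = 0 \<and> e (n + 1) = 0" for n
  proof (induction n)
    case 0
    then show ?case using e0 e1 by simp
  next
    case (Suc n)
    then show ?case using rec[of "n + 1"] q by simp
  qed
  then show ?thesis by blast
qed

section \<open>Asymptotics of the Beta function\<close>

lemma Beta_Suc_eq_pochhammer:
  fixes a :: real
  assumes "a > 0"
  shows "Beta (real k + 1) a = fact k / pochhammer a (k + 1)"
proof -
  have "a \<notin> \<int>\<^sub>\<le>\<^sub>0" using assms by (auto elim!: nonpos_Ints_cases)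
  then show ?thesis
    by (simp add: Beta_def pochhammer_Gamma Gamma_fact[symmetric] add_ac)
qed

text \<open>By \<open>Beta_Suc_eq_pochhammer\<close>, this is Gauss's product
  \<open>Gamma_series a\<close> for Gamma.\<close>

lemma Beta_Suc_times_powr_tendsto_Gamma:
  fixes a :: real
  assumes a: "a > 0"
  shows "(\<lambda>k. Beta (real k + 1) a * real k powr a) \<longlonglongrightarrow> Gamma a"
proof (rule Lim_transform_eventually[OF Gamma_series_LIMSEQ[of a]])
  show "\<forall>\<^sub>F k in sequentially. Gamma_series a k = Beta (real k + 1) a * real k powr a"
    \<comment> \<open>At \<open>k = 0\<close> the two differ: \<open>0 powr a\<close> is 0, while
      the exponential in \<open>Gamma_series\<close> is positive.\<close>
    using eventually_gt_at_top[of 0]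
    by eventually_elim (simp add: Gamma_series_def Beta_Suc_eq_pochhammer[OF a] powr_def)
qed

lemma has_integral_power_Beta:
  fixes a :: real
  assumes a: "a > 0"
  shows "((\<lambda>s. s ^ k * (1 - s) powr (a - 1)) has_integral Beta (real k + 1) a) {0..1}"
proof (rule has_integral_spike_finite)
  show "((\<lambda>s. s powr (real k + 1 - 1) * (1 - s) powr (a - 1)) has_integral Beta (real k + 1) a) {0..1}"
    by (rule has_integral_Beta_real) (use a in auto)
  \<comment> \<open>The point 0 is exceptional because \<open>0 powr 0\<close> is 0 but
    \<open>0 ^ 0\<close> is 1.\<close>
  show "finite {0 :: real}" by simp
  show "s ^ k * (1 - s) powr (a - 1) = s powr (real k + 1 - 1) * (1 - s) powr (a - 1)"
    if "s \<in> {0..1} - {0}" for s :: real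
    using that by (simp add: powr_realpow)
qed

section \<open>The weight, its moments and their recurrence\<close>

context
  fixes a r :: real
  assumes a: "0 < a" and r: "0 < r" "r < 1"
begin

definition weight :: "real \<Rightarrow> real" where
  "weight s = (1 - s) powr (a - 1) * (1 - r * s) powr (- a - 1)"

definition moment :: "nat \<Rightarrow> real" where
  "moment k = integral {0..1} (\<lambda>s. s ^ k * weight s)"

text \<open>Equals \<open>weight\<close> times the quadratic \<open>(1 - s) * (1 - r * s)\<close>,
  while its derivative is a constant multiple of \<open>weight\<close>. Integration by parts
  therefore links three consecutive moments.\<close>

definition primitive :: "real \<Rightarrow> real" where
  "primitive s = (1 - s) powr a * (1 - r * s) powr (- a)"

lemma one_minus_rs_pos: "1 - r * s > 0" if "s \<le> 1"
proof -
  have "r * s \<le> r * 1" using that r by (intro mult_left_mono) auto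
  then show ?thesis using r by linarith
qed

lemma weight_nonneg: "weight s \<ge> 0"
  by (simp add: weight_def)

lemma continuous_on_primitive: "continuous_on {0..1} primitive"
  unfolding primitive_def
proof (intro continuous_on_mult continuous_on_powr')
  show "\<forall>s\<in>{0..1}. 0 \<le> 1 - r * s \<and> (1 - r * s = 0 \<longrightarrow> 0 < - a)"
    using one_minus_rs_pos by force
qed (use a in \<open>auto intro!: continuous_intros\<close>)

lemma primitive_eq:
  assumes "s < 1"
  shows "primitive s = (1 - s) * (1 - r * s) * weight s"
proof -
  have "(1 - s) powr a = (1 - s) * (1 - s) powr (a - 1)"
    "(1 - r * s) powr (- a) = (1 - r * s) * (1 - r * s) powr (- a - 1)"
    using assms one_minus_rs_pos[of s] by (simp_all add: powr_diff)
  then show ?thesis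
    by (simp only: primitive_def weight_def mult_ac)
qed

lemma primitive_deriv:
  assumes s: "s < 1"
  shows "(primitive has_real_derivative - a * (1 - r) * weight s) (at s)"
proof -
  have pos: "1 - s > 0" "1 - r * s > 0" using s one_minus_rs_pos[of s] by auto
  have "(primitive has_real_derivative
      (- a * (1 - s) powr (a - 1)) * (1 - r * s) powr (- a)
      + (1 - s) powr a * (a * r * (1 - r * s) powr (- a - 1))) (at s)"
    unfolding primitive_def
    using pos by (auto intro!: derivative_eq_intros)
  also have "(- a * (1 - s) powr (a - 1)) * (1 - r * s) powr (- a)
      + (1 - s) powr a * (a * r * (1 - r * s) powr (- a - 1)) = - a * (1 - r) * weight s"
  proof -
    have "(1 - s) powr a = (1 - s) * (1 - s) powr (a - 1)"
      "(1 - r * s) powr (- a) = (1 - r * s) * (1 - r * s) powr (- a - 1)"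
      using pos by (simp_all add: powr_diff)
    then show ?thesis
      unfolding weight_def by (simp only:) (simp add: algebra_simps)
  qed
  finally show ?thesis .
qed

text \<open>Integrability and value come together from the antiderivative \<open>primitive\<close>.
  The interior form of the fundamental theorem is needed since \<open>weight\<close> blows up near 1
  when \<open>a < 1\<close>.\<close>

lemma weight_has_integral: "(weight has_integral 1 / (a * (1 - r))) {0..1}"
proof -
  have "((\<lambda>s. - a * (1 - r) * weight s) has_integral primitive 1 - primitive 0) {0..1}"
    by (rule fundamental_theorem_of_calculus_interior)
      (use continuous_on_primitive primitive_deriv in
        \<open>auto simp: has_real_derivative_iff_has_vector_derivative[symmetric]\<close>)
  from has_integral_mult_right[OF this, of "- 1 / (a * (1 - r))"]
  have "((\<lambda>s. - 1 / (a * (1 - r)) * (- a * (1 - r) * weight s)) has_integral 1 / (a * (1 - r))) {0..1}"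
    by (simp add: primitive_def)
  moreover have "- 1 / (a * (1 - r)) * (- a * (1 - r) * w) = w" for w
    using a r by simp
  ultimately show ?thesis by simp
qed

lemma moment_has_integral: "((\<lambda>s. s ^ k * weight s) has_integral moment k) {0..1}"
proof -
  have "weight absolutely_integrable_on {0..1}"
    using weight_has_integral weight_nonneg
    by (intro nonnegative_absolutely_integrable_1) auto
  moreover have "continuous_on {0..1} (\<lambda>s::real. s ^ k)"
    by (intro continuous_intros)
  ultimately have "(\<lambda>s. s ^ k * weight s) absolutely_integrable_on {0..1}"
    by (intro absolutely_integrable_bounded_measurable_product_real
        continuous_imp_measurable_on_sets_lebesgue compact_imp_bounded
        compact_continuous_image) auto
  then show ?thesis
    unfolding moment_def
    by (intro integrable_integral set_lebesgue_integral_eq_integral(1))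
qed

lemma moment_0: "moment 0 = 1 / (a * (1 - r))"
  using moment_has_integral[of 0] weight_has_integral by (auto dest: has_integral_unique)

text \<open>Both sides differ by the integral of the derivative of \<open>s ^ k * primitive s\<close>, which
  vanishes at both endpoints.\<close>

lemma moment_rec:
  assumes k: "k \<ge> 1"
  shows "real k * moment (k - 1) - real k * (1 + r) * moment k + real k * r * moment (k + 1)
       = a * (1 - r) * moment k"
proof -
  let ?f = "\<lambda>s. real k * (s ^ (k - 1) * weight s) - real k * (1 + r) * (s ^ k * weight s)
        + real k * r * (s ^ (k + 1) * weight s) - a * (1 - r) * (s ^ k * weight s)"
  have "(?f has_integral real k * moment (k - 1) - real k * (1 + r) * moment k
        + real k * r * moment (k + 1) - a * (1 - r) * moment k) {0..1}"
    by (intro has_integral_add has_integral_diff has_integral_mult_right moment_has_integral)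
  moreover have "(?f has_integral (1 ^ k * primitive 1 - 0 ^ k * primitive 0)) {0..1}"
  proof (rule fundamental_theorem_of_calculus_interior)
    show "continuous_on {0..1} (\<lambda>s. s ^ k * primitive s)"
      by (intro continuous_intros continuous_on_primitive)
    fix s :: real
    assume s: "s \<in> {0<..<1}"
    have "((\<lambda>s. s ^ k * primitive s) has_real_derivative
        real k * s ^ (k - 1) * primitive s + s ^ k * (- a * (1 - r) * weight s)) (at s)"
      using s by (auto intro!: derivative_eq_intros primitive_deriv)
    \<comment> \<open>Expanding \<open>(1 - s) * (1 - r * s)\<close> gives the coefficients 1,
      \<open>- (1 + r)\<close> and \<open>r\<close> of the three moments.\<close>
    also have "real k * s ^ (k - 1) * primitive s + s ^ k * (- a * (1 - r) * weight s) = ?f s"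
      using s k by (cases k) (auto simp: primitive_eq algebra_simps)
    finally show "((\<lambda>s. s ^ k * primitive s) has_vector_derivative ?f s) (at s)"
      by (simp only: has_real_derivative_iff_has_vector_derivative)
  qed simp
  ultimately have "real k * moment (k - 1) - real k * (1 + r) * moment k
        + real k * r * moment (k + 1) - a * (1 - r) * moment k
      = 1 ^ k * primitive 1 - 0 ^ k * primitive 0"
    by (rule has_integral_unique)
  then show ?thesis
    using k by (simp add: primitive_def power_0_left)
qed

section \<open>Two-sided bounds and asymptotics of the moments\<close>

lemma powr_one_minus_rs_bounds:
  assumes s: "0 \<le> s" "s \<le> 1"
  shows "(1 - r * s) powr (- a - 1) \<le> (1 - r) powr (- a - 1)"
    and "(1 - r) powr (- a - 1) - (a + 1) * (1 - r) powr (- a - 2) * (1 - s)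
           \<le> (1 - r * s) powr (- a - 1)"
proof -
  have le: "r * t \<le> r" if "t \<le> 1" for t
    using mult_left_mono[OF that, of r] r by simp
  show "(1 - r * s) powr (- a - 1) \<le> (1 - r) powr (- a - 1)"
    using le[of s] s r a by (intro powr_mono2') auto
  show "(1 - r) powr (- a - 1) - (a + 1) * (1 - r) powr (- a - 2) * (1 - s)
           \<le> (1 - r * s) powr (- a - 1)"
  proof (cases "s = 1")
    case False
    then have "s < 1" using s by simp
    moreover have "((\<lambda>t. (1 - r * t) powr (- a - 1)) has_real_derivative
        (a + 1) * r * (1 - r * t) powr (- a - 2)) (at t)" if "t \<le> 1" for t
      using one_minus_rs_pos[OF that] by (auto intro!: derivative_eq_intros simp: algebra_simps)
    ultimately obtain t where t: "s < t" "t < 1"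
      and eq: "(1 - r * 1) powr (- a - 1) - (1 - r * s) powr (- a - 1)
        = (1 - s) * ((a + 1) * r * (1 - r * t) powr (- a - 2))"
      using MVT2[of s 1 "\<lambda>t. (1 - r * t) powr (- a - 1)"
          "\<lambda>t. (a + 1) * r * (1 - r * t) powr (- a - 2)"] by auto
    \<comment> \<open>The derivative is largest at 1; its factor \<open>r\<close> is also bounded by
      1, which gives the Lipschitz constant.\<close>
    have "(a + 1) * r * (1 - r * t) powr (- a - 2) \<le> (a + 1) * 1 * (1 - r) powr (- a - 2)"
      using le[of t] t r a by (intro mult_mono powr_mono2') auto
    then have "(1 - s) * ((a + 1) * r * (1 - r * t) powr (- a - 2))
        \<le> (1 - s) * ((a + 1) * (1 - r) powr (- a - 2))"
      using \<open>s < 1\<close> by (intro mult_left_mono) auto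
    then show ?thesis
      using eq by (simp add: algebra_simps)
  qed simp
qed

lemma moment_upper: "moment k \<le> (1 - r) powr (- a - 1) * Beta (real k + 1) a"
proof (rule has_integral_le[OF moment_has_integral
      has_integral_mult_right[OF has_integral_power_Beta[OF a]]])
  fix s :: real
  assume "s \<in> {0..1}"
  then have "s ^ k * (1 - s) powr (a - 1) * (1 - r * s) powr (- a - 1)
      \<le> s ^ k * (1 - s) powr (a - 1) * (1 - r) powr (- a - 1)"
    by (intro mult_left_mono powr_one_minus_rs_bounds) auto
  then show "s ^ k * weight s \<le> (1 - r) powr (- a - 1) * (s ^ k * (1 - s) powr (a - 1))"
    by (simp add: weight_def mult_ac)
qed

text \<open>The Lipschitz error carries a factor \<open>1 - s\<close>, which raises the second Beta
  parameter from \<open>a\<close> to \<open>a + 1\<close>.\<close>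

lemma moment_lower:
  "(1 - r) powr (- a - 1) * Beta (real k + 1) a
     - (a + 1) * (1 - r) powr (- a - 2) * Beta (real k + 1) (a + 1) \<le> moment k"
proof -
  have a1: "a + 1 > 0" using a by simp
  show ?thesis
  proof (rule has_integral_le[OF has_integral_diff[OF
          has_integral_mult_right[OF has_integral_power_Beta[OF a]]
          has_integral_mult_right[OF has_integral_power_Beta[OF a1]]] moment_has_integral])
    fix s :: real
    assume s: "s \<in> {0..1}"
    have "s ^ k * (1 - s) powr (a - 1)
          * ((1 - r) powr (- a - 1) - (a + 1) * (1 - r) powr (- a - 2) * (1 - s))
        \<le> s ^ k * (1 - s) powr (a - 1) * (1 - r * s) powr (- a - 1)"
      using s by (intro mult_left_mono powr_one_minus_rs_bounds) auto
    moreover have "(1 - s) powr (a + 1 - 1) = (1 - s) * (1 - s) powr (a - 1)"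
      using s by (cases "s = 1") (auto simp: powr_diff)
    ultimately show "(1 - r) powr (- a - 1) * (s ^ k * (1 - s) powr (a - 1))
        - (a + 1) * (1 - r) powr (- a - 2) * (s ^ k * (1 - s) powr (a + 1 - 1))
        \<le> s ^ k * weight s"
      by (simp only: weight_def) (simp add: algebra_simps)
  qed
qed

lemma moment_tendsto:
  "(\<lambda>k. moment k * real k powr a) \<longlonglongrightarrow> (1 - r) powr (- a - 1) * Gamma a"
proof (rule tendsto_sandwich)
  let ?C = "(1 - r) powr (- a - 1)" and ?L = "(a + 1) * (1 - r) powr (- a - 2)"
  let ?B = "\<lambda>k. Beta (real k + 1) a * real k powr a"
  note B = Beta_Suc_times_powr_tendsto_Gamma[OF a]
  show "\<forall>\<^sub>F k in sequentially. moment k * real k powr a \<le> ?C * ?B k"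
    using moment_upper by (auto intro!: always_eventually simp flip: mult.assoc intro: mult_right_mono)
  show "\<forall>\<^sub>F k in sequentially. (?C - ?L * (a / (real k + 1 + a))) * ?B k \<le> moment k * real k powr a"
  proof (intro always_eventually allI)
    fix k
    \<comment> \<open>The error term is thus the main Beta term times
      \<open>a / (real k + 1 + a)\<close>, which tends to 0.\<close>
    have "(real k + 1 + a) * Beta (real k + 1) (a + 1) = a * Beta (real k + 1) a"
      using a by (intro Beta_plus1_right) (auto elim!: nonpos_Ints_cases)
    then have "Beta (real k + 1) (a + 1) = a / (real k + 1 + a) * Beta (real k + 1) a"
      using a by (simp add: field_simps)
    then have "(?C - ?L * (a / (real k + 1 + a))) * Beta (real k + 1) a \<le> moment k"
      using moment_lower[of k] by (simp add: algebra_simps)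
    then show "(?C - ?L * (a / (real k + 1 + a))) * ?B k \<le> moment k * real k powr a"
      unfolding mult.assoc[symmetric] by (rule mult_right_mono) simp
  qed
  show "(\<lambda>k. ?C * ?B k) \<longlonglongrightarrow> ?C * Gamma a"
    by (intro tendsto_intros B)
  have "(\<lambda>k. a / (real k + 1 + a)) \<longlonglongrightarrow> 0"
    by real_asymp
  then have "(\<lambda>k. (?C - ?L * (a / (real k + 1 + a))) * ?B k) \<longlonglongrightarrow> (?C - ?L * 0) * Gamma a"
    by (intro tendsto_mult[OF _ B] tendsto_diff tendsto_mult_left tendsto_const)
  then show "(\<lambda>k. (?C - ?L * (a / (real k + 1 + a))) * ?B k) \<longlonglongrightarrow> ?C * Gamma a"
    by simp
qed

text \<open>As \<open>1 - r * s\<close> lies in (0, 1], its negative power is at least 1, so the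
  moment dominates a positive Beta value.\<close>

lemma moment_pos: "moment k > 0"
proof -
  have "Beta (real k + 1) a \<le> moment k"
  proof (rule has_integral_le[OF has_integral_power_Beta[OF a] moment_has_integral])
    fix s :: real
    assume s: "s \<in> {0..1}"
    then have "1 powr (- a - 1) \<le> (1 - r * s) powr (- a - 1)"
      using a r one_minus_rs_pos[of s] by (intro powr_mono2') auto
    then have "s ^ k * (1 - s) powr (a - 1) * 1 \<le> s ^ k * (1 - s) powr (a - 1) * (1 - r * s) powr (- a - 1)"
      using s by (intro mult_left_mono) auto
    then show "s ^ k * (1 - s) powr (a - 1) \<le> s ^ k * weight s"
      by (simp add: weight_def mult_ac)
  qed
  moreover have "Beta (real k + 1) a > 0"
    using a by (auto simp: Beta_def intro!: divide_pos_pos mult_pos_pos Gamma_real_pos)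
  ultimately show ?thesis by linarith
qed

lemma moment_le_moment_0: "moment k \<le> moment 0"
proof (rule has_integral_le[OF moment_has_integral moment_has_integral])
  show "s ^ k * weight s \<le> s ^ 0 * weight s" if "s \<in> {0..1}" for s
    using that by (intro mult_right_mono weight_nonneg) (auto intro: power_le_one)
qed

end

section \<open>The solution of the original recurrence\<close>

theorem theorem4p4:
  fixes p \<beta> \<gamma> :: real
  assumes "0 < p" and "p < 1 / 2"
    and "\<beta> = p / (2 * p - 1)" and "\<gamma> = (1 - p) / p"
  shows "(\<exists>!d. pos_bounded_solution p d) \<and>
    (\<forall>d. pos_bounded_solution p d \<longrightarrow>
      d \<sim>[at_top] (\<lambda>k. inverse (- \<beta>) * (1 - \<beta>) powr (1 - \<beta>) * Gamma (1 - \<beta>)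
                         * inverse (\<gamma> ^ k) * real k powr \<beta>))"
proof -
  define a where "a = - \<beta>"
  define r where "r = p / (1 - p)"
  define d where "d k = r ^ k * moment a r k" for k
  have a_eq: "a = p / (1 - 2 * p)"
    using assms(2) unfolding a_def assms(3) by (simp add: divide_simps) (simp add: algebra_simps)
  have a: "0 < a" and r: "0 < r" "r < 1"
    using assms(1,2) by (auto simp: a_eq r_def)
  have one_minus_r: "1 - r = (1 - 2 * p) / (1 - p)"
    using assms(2) by (simp add: r_def field_simps)
  \<comment> \<open>This makes \<open>moment a r 0\<close> equal to
    \<open>1 / r = (1 - p) / p\<close>, so \<open>d\<close> needs no normalising constant.\<close>
  have ar: "a * (1 - r) = r"
    using assms(2) unfolding one_minus_r by (simp add: a_eq r_def)
  have inv_r: "1 - r = inverse (1 + a)"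
    using assms(1,2) unfolding one_minus_r by (simp add: a_eq field_simps)
  have d_pos: "d k > 0" for k
    using moment_pos[OF a r] r by (simp add: d_def)
  have d_rec: "(real k + p) * d k = p * real k * d (k - 1) + (1 - p) * real k * d (k + 1)"
    if k: "k \<ge> 1" for k
  proof -
    have q: "(1 - p) * r = p" using assms(2) by (simp add: r_def)
    obtain j where j: "k = Suc j" using k by (cases k) auto
    let ?m = "moment a r"
    have "(1 - p) * (real k * ?m j - real k * (1 + r) * ?m k + real k * r * ?m (k + 1))
        = (1 - p) * (r * ?m k)"
      using moment_rec[OF a r k] j by (simp add: ar)
    then have "(1 - p) * real k * ?m j - real k * ((1 - p) + (1 - p) * r) * ?m k
        + real k * ((1 - p) * r) * ?m (k + 1) = ((1 - p) * r) * ?m k"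
      by (simp only: algebra_simps)
    then have "(real k + p) * ?m k = (1 - p) * real k * ?m j + p * real k * ?m (k + 1)"
      unfolding q by (simp add: algebra_simps)
    \<comment> \<open>The moments satisfy the desired recurrence with \<open>p\<close> and
      \<open>1 - p\<close> exchanged; since \<open>(1 - p) * r = p\<close>, the factor
      \<open>r ^ k\<close> exchanges them back.\<close>
    then have "r ^ k * ((real k + p) * ?m k) = r ^ k * ((1 - p) * real k * ?m j + p * real k * ?m (k + 1))"
      by (rule arg_cong)
    also have "\<dots> = r ^ j * (((1 - p) * r) * real k * ?m j + p * real k * r * ?m (k + 1))"
      by (simp add: j algebra_simps)
    also have "\<dots> = r ^ j * (p * real k * ?m j + ((1 - p) * r) * real k * r * ?m (k + 1))"
      unfolding q ..
    finally show ?thesis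
      by (simp add: d_def j algebra_simps)
  qed
  have d_sol: "pos_bounded_solution p d"
    unfolding pos_bounded_solution_def
  proof (intro conjI allI impI)
    show "d k > 0" for k by (rule d_pos)
    have "\<bar>d k\<bar> \<le> moment a r 0" for k
    proof -
      have "d k \<le> 1 * moment a r 0"
        unfolding d_def using r moment_pos[OF a r] moment_le_moment_0[OF a r]
        by (intro mult_mono power_le_one) (auto intro: less_imp_le)
      then show ?thesis using d_pos[of k] by simp
    qed
    then show "bounded (range d)" by (auto simp: bounded_iff)
    show "d 0 = (1 - p) / p"
      using assms(1,2) by (simp add: d_def moment_0[OF a r] ar) (simp add: r_def)
    show "d k = (p * real k * d (k - 1) + (1 - p) * real k * d (k + 1)) / (real k + p)"
      if "1 \<le> k" for k
      using d_rec[OF that] assms(1) by (simp add: field_simps)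
  qed
  have unique: "d' = d" if d': "pos_bounded_solution p d'" for d'
  proof
    fix k
    have "d' k - d k = 0"
    proof (rule bounded_solution_eq_0[where e = "\<lambda>k. d' k - d k" and p = p and q = "1 - p"])
      show "bounded (range (\<lambda>k. d' k - d k))"
        using d' d_sol unfolding pos_bounded_solution_def by (intro bounded_minus_comp) auto
      show "d' 0 - d 0 = 0"
        using d' d_sol unfolding pos_bounded_solution_def by simp
      fix k :: nat
      assume k: "k \<ge> 1"
      have "(real k + p) * d' k = p * real k * d' (k - 1) + (1 - p) * real k * d' (k + 1)"
        using d' k assms(1) unfolding pos_bounded_solution_def by (simp add: field_simps)
      then show "(real k + p) * (d' k - d k)
          = p * real k * (d' (k - 1) - d (k - 1)) + (1 - p) * real k * (d' (k + 1) - d (k + 1))"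
        using d_rec[OF k] by (simp add: algebra_simps)
    qed (use assms(1,2) in auto)
    then show "d' k = d k" by simp
  qed
  have "d \<sim>[at_top] (\<lambda>k. inverse (- \<beta>) * (1 - \<beta>) powr (1 - \<beta>) * Gamma (1 - \<beta>)
                         * inverse (\<gamma> ^ k) * real k powr \<beta>)"
  proof (rule asymp_equivI')
    let ?C = "(1 - r) powr (- a - 1) * Gamma a"
    have C_pos: "?C > 0"
      using a r by (simp add: Gamma_real_pos)
    have "a \<notin> \<int>\<^sub>\<le>\<^sub>0"
      using a by (auto elim!: nonpos_Ints_cases)
    then have "Gamma (1 + a) = a * Gamma a"
      using Gamma_plus1[of a] by (simp add: add.commute)
    moreover have "(1 - r) powr (- a - 1) = (1 + a) powr (1 + a)"
      using a unfolding inv_r by (simp add: powr_minus[symmetric] inverse_powr)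
    \<comment> \<open>\<open>Gamma (1 + a) = a * Gamma a\<close> absorbs
      \<open>inverse (- \<beta>)\<close>, and \<open>1 - r\<close> is the inverse of
      \<open>1 - \<beta>\<close>.\<close>
    ultimately have C: "inverse (- \<beta>) * (1 - \<beta>) powr (1 - \<beta>) * Gamma (1 - \<beta>) = ?C"
      using a by (simp add: a_def)
    have \<gamma>: "inverse (\<gamma> ^ k) = r ^ k" for k
      by (simp add: assms(4) r_def power_inverse[symmetric])
    \<comment> \<open>At \<open>k = 0\<close> both sides are 0, as \<open>0 powr x = 0\<close> and
      division by zero gives 0.\<close>
    have "d k / (?C * inverse (\<gamma> ^ k) * real k powr \<beta>) = moment a r k * real k powr a / ?C" for k
      using r(1) unfolding \<gamma> d_def by (simp add: a_def powr_minus field_simps)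
    moreover have "(\<lambda>k. moment a r k * real k powr a / ?C) \<longlonglongrightarrow> 1"
      using tendsto_divide[OF moment_tendsto[OF a r] tendsto_const, of ?C] C_pos
      by (simp only: divide_self less_imp_neq[symmetric] not_False_eq_True)
    ultimately show "(\<lambda>k. d k / (inverse (- \<beta>) * (1 - \<beta>) powr (1 - \<beta>) * Gamma (1 - \<beta>)
                         * inverse (\<gamma> ^ k) * real k powr \<beta>)) \<longlonglongrightarrow> 1"
      unfolding C by simp
  qed
  then show ?thesis using d_sol unique by blast
qed

end
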